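(* Let $n\ge 1$ and $\ell\ge 0$ be integers and let $\mathfrak g$ be of type $A_n^{(1)}$. Let $P^+_{\mathrm{cl},\ell}$ be the set of classical dominant integral weights of level $\ell$, let the cyclic group $C_{n+1}=\langle\sigma\rangle$ of order $n+1$ act on $P^+_{\mathrm{cl},\ell}$ by $$\sigma\cdot\sum_{i=0}^n m_i\Lambda_i=\sum_{i=0}^n m_{i+1}\Lambda_i,\qquad m_{n+1}:=m_0,$$ and let $$P^+_{\mathrm{cl},\ell}(q)=\sum_{\sum_i m_i\Lambda_i\in P^+_{\mathrm{cl},\ell}} q^{\,\sum_{i=1}^n i\,m_i}.$$ Then the triple $\bigl(P^+_{\mathrm{cl},\ell},\,C_{n+1},\,P^+_{\mathrm{cl},\ell}(q)\bigr)$ exhibits the cyclic sieving phenomenon.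
   Context: For type $A_n^{(1)}$, with fundamental weights $\Lambda_0,\dots,\Lambda_n$ (all of level $1$), the set of classical dominant integral weights of level $\ell$ (dominant integral weights of level $\ell$ modulo $\mathbb Z\delta$, $\delta$ the null root) is identified with $P^+_{\mathrm{cl},\ell}=\{\sum_{i=0}^n m_i\Lambda_i : m_i\in\mathbb Z_{\ge0},\ \sum_{i=0}^n m_i=\ell\}$. Cyclic sieving phenomenon: for a finite set $X$ with an action of a finite cyclic group $C$, and a polynomial $X(q)$ with nonnegative integer coefficients, the triple $(X,C,X(q))$ exhibits the cyclic sieving phenomenon if for every $g\in C$ one has $|X^g|=X(\omega_{o(g)})$, where $o(g)$ is the order of $g$, $\omega_d$ is a primitive $d$-th root of unity, and $X^g$ is the set of points fixed by $g$. *)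

theory Defs
  imports
    Complex_Main
    "HOL-Computational_Algebra.Polynomial"
    "HOL-Algebra.Multiplicative_Group"
    "HOL-Algebra.Elementary_Groups"
    "HOL-Algebra.Group_Action"
begin

definition primitive_root_of_unity :: "nat \<Rightarrow> complex \<Rightarrow> bool" where
  "primitive_root_of_unity d z \<longleftrightarrow>
     0 < d \<and> z ^ d = 1 \<and> (\<forall>k. 0 < k \<and> k < d \<longrightarrow> z ^ k \<noteq> 1)"

text \<open>The type of \<open>p\<close> encodes that its coefficients are nonnegative integers. The defining
  equation is required for every primitive root of unity of the relevant order, so that no
  particular one has to be chosen.\<close>

definition cyclic_sieving ::
  "('g, 'm) monoid_scheme \<Rightarrow> 'x set \<Rightarrow> ('g \<Rightarrow> 'x \<Rightarrow> 'x) \<Rightarrow> nat poly \<Rightarrow> bool" where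
  "cyclic_sieving G X \<phi> p \<longleftrightarrow>
     finite X \<and> finite (carrier G) \<and> cyclic_group G \<and> group_action G X \<phi> \<and>
     (\<forall>g \<in> carrier G. \<forall>\<omega>. primitive_root_of_unity (group.ord G g) \<omega> \<longrightarrow>
        of_nat (card (invariants X \<phi> g)) = poly (map_poly of_nat p) \<omega>)"

text \<open>A classical dominant integral weight \<open>\<Sum>i\<le>n. m\<^sub>i \<Lambda>\<^sub>i\<close> of type \<open>A\<^sub>n\<^sup>(\<^sup>1\<^sup>)\<close> (taken modulo the
  null root) is represented by its coefficient function \<open>m\<close>, set to \<open>0\<close> outside \<open>{0..n}\<close> so
  that distinct functions are distinct weights. As every \<open>\<Lambda>\<^sub>i\<close> has level \<open>1\<close>, the level
  is \<open>\<Sum>i\<le>n. m\<^sub>i\<close>.\<close>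

definition level :: "nat \<Rightarrow> (nat \<Rightarrow> nat) \<Rightarrow> nat" where
  "level n m = (\<Sum>i = 0..n. m i)"

definition P_cl :: "nat \<Rightarrow> nat \<Rightarrow> (nat \<Rightarrow> nat) set" where
  "P_cl n l = {m. (\<forall>i. n < i \<longrightarrow> m i = 0) \<and> level n m = l}"

definition weight_rot :: "nat \<Rightarrow> (nat \<Rightarrow> nat) \<Rightarrow> (nat \<Rightarrow> nat)" where
  "weight_rot n m = (\<lambda>i. if i < n then m (i + 1) else if i = n then m 0 else 0)"

text \<open>The element \<open>k\<close> of \<open>integer_mod_group (n + 1)\<close>, with \<open>0 \<le> k \<le> n\<close>, stands for \<open>\<sigma>\<^sup>k\<close>. The
  restriction is needed because \<^locale>\<open>group_action\<close> takes extensional maps.\<close>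

definition rot_action :: "nat \<Rightarrow> nat \<Rightarrow> int \<Rightarrow> (nat \<Rightarrow> nat) \<Rightarrow> (nat \<Rightarrow> nat)" where
  "rot_action n l k = restrict (weight_rot n ^^ nat k) (P_cl n l)"

definition P_cl_poly :: "nat \<Rightarrow> nat \<Rightarrow> nat poly" where
  "P_cl_poly n l = (\<Sum>m \<in> P_cl n l. Polynomial.monom 1 (\<Sum>i = 1..n. i * m i))"

end

(* Both sides are coefficients of t^l. If w is a primitive d-th root of unity and n + 1 = s d,
   then P(w) is the coefficient in the product of 1 / (1 - w^i t) over i = 0, ..., n, which equals
   1 / (1 - t^d)^s. A power of sigma of order d fixes exactly the s-periodic weights m; sending m
   to d (m_0, ..., m_(s-1)) matches them with the s-tuples of multiples of d that sum to l, and
   these are counted by the same coefficient. *)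

theory Submission
  imports Defs "HOL-Computational_Algebra.Polynomial_FPS"
begin

section \<open>Coefficients of finite products of power series\<close>

text \<open>The product formula \<open>fps_prod_nth'\<close> is indexed by multisets, while weights
  are functions; this translates between the two index sets.\<close>

lemma bij_betw_count_multisets_of_size:
  assumes "finite A"
  shows "bij_betw count (multisets_of_size A l) {m. (\<forall>i. i \<notin> A \<longrightarrow> m i = 0) \<and> sum m A = l}"
proof -
  have size: "size X = sum (count X) A" if "set_mset X \<subseteq> A" for X
    unfolding size_multiset_overloaded_eq
    by (rule sum.mono_neutral_left) (use that assms in \<open>auto simp: not_in_iff\<close>)
  show ?thesis
  proof (rule bij_betw_imageI)
    show "inj_on count (multisets_of_size A l)"
      by (simp add: inj_on_def count_inject)
    show "count ` multisets_of_size A l = {m. (\<forall>i. i \<notin> A \<longrightarrow> m i = 0) \<and> sum m A = l}"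
    proof (intro equalityI subsetI)
      fix m assume "m \<in> count ` multisets_of_size A l"
      then show "m \<in> {m. (\<forall>i. i \<notin> A \<longrightarrow> m i = 0) \<and> sum m A = l}"
        using size by (auto simp: multisets_of_size_def subset_iff simp flip: not_in_iff)
    next
      fix m assume m: "m \<in> {m. (\<forall>i. i \<notin> A \<longrightarrow> m i = 0) \<and> sum m A = l}"
      then have supp: "{x. 0 < m x} \<subseteq> A"
        by (smt (verit, best) bot_nat_0.not_eq_extremum mem_Collect_eq subsetI)
      \<comment> \<open>Finite support is what makes \<open>Abs_multiset\<close> a right inverse of
        \<open>count\<close> at \<open>m\<close>.\<close>
      then have "finite {x. 0 < m x}"
        by (rule finite_subset[OF _ assms])
      then have c: "count (Abs_multiset m) = m"
        by (rule count_Abs_multiset)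
      then have "set_mset (Abs_multiset m) \<subseteq> A"
        using supp by (simp add: set_mset_def)
      with c m size show "m \<in> count ` multisets_of_size A l"
        by (intro image_eqI[of _ _ "Abs_multiset m"]) (auto simp: multisets_of_size_def)
    qed
  qed
qed

lemma fps_prod_nth_fun:
  fixes f :: "'a \<Rightarrow> 'b :: comm_ring_1 fps"
  assumes "finite A"
  shows "fps_nth (\<Prod>x\<in>A. f x) l =
    (\<Sum>m | (\<forall>i. i \<notin> A \<longrightarrow> m i = 0) \<and> sum m A = l. \<Prod>x\<in>A. fps_nth (f x) (m x))"
  unfolding fps_prod_nth'[OF assms]
  by (rule sum.reindex_bij_betw[OF bij_betw_count_multisets_of_size[OF assms]])

lemma finite_weak_compositions:
  assumes "finite A"
  shows "finite {m :: 'a \<Rightarrow> nat. (\<forall>i. i \<notin> A \<longrightarrow> m i = 0) \<and> sum m A = l}"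
  using bij_betw_finite[OF bij_betw_count_multisets_of_size[OF assms]] finite_multisets_of_size[OF assms]
  by blast

section \<open>Geometric series at powers of a root of unity\<close>

lemma fps_geometric_mult:
  fixes c :: "'a :: comm_ring_1"
  shows "Abs_fps (\<lambda>k. c ^ k) * (1 - fps_const c * fps_X) = 1"
proof (rule fps_ext)
  fix k
  show "fps_nth (Abs_fps (\<lambda>k. c ^ k) * (1 - fps_const c * fps_X)) k = fps_nth 1 k"
    by (cases k) (simp_all add: ring_distribs mult.assoc[symmetric] fps_mult_fps_X_commute)
qed

lemma fps_geometric_power_mult:
  assumes "0 < d"
  shows "Abs_fps (\<lambda>k. if d dvd k then 1 else 0 :: 'a :: comm_ring_1) * (1 - fps_X ^ d) = 1"
  by (rule fps_ext) (use assms in \<open>auto simp: ring_distribs fps_X_power_mult_right_nth dvd_imp_le dvd_minus_self\<close>)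

text \<open>Both sides have degree at most \<open>d\<close> and agree at \<open>d + 1\<close>
  points: the \<open>d\<close> powers of \<open>w\<close>, distinct by primitivity, and
  \<open>0\<close>, where both equal \<open>1\<close>.\<close>

lemma poly_prod_root_powers:
  assumes "primitive_root_of_unity d w"
  shows "(\<Prod>i<d. [:1, - (w ^ i):]) = 1 - Polynomial.monom 1 d"
proof (rule poly_eqI_degree)
  let ?A = "insert 0 ((\<lambda>i. w ^ i) ` {..<d})"
  have d: "0 < d" and wd: "w ^ d = 1" and prim: "\<And>k. 0 < k \<Longrightarrow> k < d \<Longrightarrow> w ^ k \<noteq> 1"
    using assms by (auto simp: primitive_root_of_unity_def)
  have w0: "w \<noteq> 0"
    using d wd by (auto simp: power_0_left)
  have neq: "w ^ i \<noteq> w ^ j" if "i < j" "j < d" for i j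
  proof
    assume "w ^ i = w ^ j"
    also have "w ^ j = w ^ i * w ^ (j - i)"
      using that by (simp flip: power_add)
    finally show False
      using prim[of "j - i"] that w0 by simp
  qed
  have "inj_on (\<lambda>i. w ^ i) {..<d}"
    by (rule linorder_inj_onI) (use neq in auto)
  then have card: "card ?A = Suc d"
    using w0 by (subst card_insert_disjoint) (auto simp: card_image)
  have "degree (\<Prod>i<d. [:1, - (w ^ i):]) \<le> (\<Sum>i<d. degree [:1, - (w ^ i):])"
    by (rule degree_prod_sum_le[unfolded o_def]) simp
  also have "\<dots> \<le> (\<Sum>i<d. 1)"
    by (intro sum_mono) (simp add: degree_pCons_le)
  finally show "degree (\<Prod>i<d. [:1, - (w ^ i):]) < card ?A"
    using card by simp
  show "degree (1 - Polynomial.monom 1 d :: complex poly) < card ?A"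
    using card degree_diff_le[of 1 d "Polynomial.monom (1::complex) d"]
    by (simp add: degree_monom_eq)
  fix x assume "x \<in> ?A"
  then consider "x = 0" | j where "j < d" "x = w ^ j"
    by auto
  then show "poly (\<Prod>i<d. [:1, - (w ^ i):]) x = poly (1 - Polynomial.monom 1 d) x"
  proof cases
    case 1
    then show ?thesis
      using d by (simp add: poly_prod poly_monom)
  next
    case 2
    \<comment> \<open>The factor with index \<open>(d - j) mod d\<close> vanishes at
      \<open>w ^ j\<close>; the \<open>mod\<close> sends \<open>j = 0\<close> to index
      \<open>0\<close>, since \<open>d\<close> itself is out of range.\<close>
    have "w ^ ((d - j) mod d) * w ^ j = 1"
      using 2 wd by (cases "j = 0") (simp_all flip: power_add)
    then have "(\<Prod>i<d. 1 - w ^ j * w ^ i) = 0"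
      using d by (intro prod_zero bexI[of _ "(d - j) mod d"]) (auto simp: mult.commute)
    moreover have "(w ^ j) ^ d = 1"
      by (metis mult.commute power_mult power_one wd)
    ultimately show ?thesis
      using 2 by (simp add: poly_prod poly_monom)
  qed
qed

text \<open>Both series are inverse to \<open>1 - fps_X ^ d\<close>, the left one because its
  factors are inverse to the \<open>1 - w^i t\<close>, whose product is that polynomial.\<close>

lemma fps_prod_root_powers:
  assumes "primitive_root_of_unity d w"
  shows "(\<Prod>i<d. Abs_fps (\<lambda>k. (w ^ i) ^ k)) = Abs_fps (\<lambda>k. if d dvd k then 1 else 0)"
    (is "?L = ?R")
proof -
  have d: "0 < d"
    using assms by (simp add: primitive_root_of_unity_def)
  have "(\<Prod>i<d. 1 - fps_const (w ^ i) * fps_X) = fps_of_poly (\<Prod>i<d. [:1, - (w ^ i):])"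
    by (simp add: fps_of_poly_prod fps_of_poly_pCons flip: fps_const_neg)
  also have "\<dots> = 1 - fps_X ^ d"
    by (simp add: poly_prod_root_powers[OF assms] fps_of_poly_diff fps_of_poly_monom')
  finally have "?L * (1 - fps_X ^ d) = 1"
    by (metis (no_types, lifting) fps_geometric_mult prod.distrib prod.neutral)
  then have "?L * (1 - fps_X ^ d) = ?R * (1 - fps_X ^ d)"
    using fps_geometric_power_mult[OF d, where ?'a = complex] by simp
  moreover have "(1 - fps_X ^ d :: complex fps) \<noteq> 0"
    using fps_geometric_power_mult[OF d, where ?'a = complex] by (metis mult_zero_right zero_neq_one)
  ultimately show ?thesis
    using mult_right_cancel by blast
qed

text \<open>As \<open>w ^ i\<close> has period \<open>d\<close> in \<open>i\<close>, each of the
  \<open>s\<close> consecutive blocks of \<open>d\<close> factors contributes the same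
  series.\<close>

lemma fps_prod_root_powers_blocks:
  assumes "primitive_root_of_unity d w"
  shows "(\<Prod>i<s * d. Abs_fps (\<lambda>k. (w ^ i) ^ k)) = (\<Prod>j<s. Abs_fps (\<lambda>k. if d dvd k then 1 else 0))"
proof -
  have per: "w ^ (i + j * d) = w ^ i" for i j
    using assms by (simp add: primitive_root_of_unity_def power_add power_mult mult.commute[of j])
  have block: "(\<Prod>i\<in>{j * d..<j * d + d}. Abs_fps (\<lambda>k. (w ^ i) ^ k)) = (\<Prod>i<d. Abs_fps (\<lambda>k. (w ^ i) ^ k))" for j
    using prod.shift_bounds_nat_ivl[of "\<lambda>i. Abs_fps (\<lambda>k. (w ^ i) ^ k)" 0 "j * d" d]
    by (simp add: add.commute per lessThan_atLeast0)
  have "(\<Prod>i<s * d. Abs_fps (\<lambda>k. (w ^ i) ^ k)) =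
      (\<Prod>j<s. \<Prod>i\<in>{j * d..<j * d + d}. Abs_fps (\<lambda>k. (w ^ i) ^ k))"
    by (rule prod.nat_group[symmetric])
  then show ?thesis
    by (simp only: block fps_prod_root_powers[OF assms])
qed

section \<open>The weight polynomial at a root of unity\<close>

text \<open>Gives \<open>P_cl\<close> the shape of the index set in
  \<open>fps_prod_nth_fun\<close>.\<close>

lemma P_cl_eq: "P_cl n l = {m. (\<forall>i. i \<notin> {..<n + 1} \<longrightarrow> m i = 0) \<and> sum m {..<n + 1} = l}"
proof -
  have "{0..n} = {..<n + 1}"
    by auto
  then show ?thesis
    by (auto simp: P_cl_def level_def not_less Suc_le_eq)
qed

lemma finite_P_cl: "finite (P_cl n l)"
  unfolding P_cl_eq by (rule finite_weak_compositions) simp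

lemma poly_P_cl_poly:
  "poly (map_poly of_nat (P_cl_poly n l)) w = (\<Sum>m\<in>P_cl n l. \<Prod>i<n + 1. (w ^ i) ^ m i)"
  for w :: complex
proof -
  have "map_poly of_nat (P_cl_poly n l) = (\<Sum>m\<in>P_cl n l. Polynomial.monom (1::complex) (\<Sum>i = 1..n. i * m i))"
    by (rule poly_eqI) (simp add: P_cl_poly_def coeff_map_poly Polynomial.coeff_sum if_distrib cong: if_cong)
  moreover have "w ^ (\<Sum>i = 1..n. i * m i) = (\<Prod>i<n + 1. (w ^ i) ^ m i)" for m
  proof -
    \<comment> \<open>The added index \<open>0\<close> contributes
      \<open>0 * m 0 = 0\<close>.\<close>
    have "(\<Sum>i = 1..n. i * m i) = (\<Sum>i<n + 1. i * m i)"
      by (rule sum.mono_neutral_left) auto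
    then show ?thesis
      by (simp only: power_sum power_mult)
  qed
  ultimately show ?thesis
    by (simp add: poly_sum poly_monom)
qed

text \<open>The product is expanded by \<open>fps_prod_nth_fun\<close> before and after it is
  collapsed into blocks; in the second expansion every term is \<open>0\<close> or \<open>1\<close>,
  so the coefficient is a cardinality.\<close>

lemma poly_P_cl_poly_root_of_unity:
  assumes "primitive_root_of_unity d w" "n + 1 = s * d"
  shows "poly (map_poly of_nat (P_cl_poly n l)) w =
    of_nat (card {q. (\<forall>j. j \<notin> {..<s} \<longrightarrow> q j = 0) \<and> sum q {..<s} = l \<and> (\<forall>j<s. d dvd q j)})"
proof -
  let ?Q = "{q. (\<forall>j. j \<notin> {..<s} \<longrightarrow> q j = 0) \<and> sum q {..<s} = l}"
  have fin: "finite ?Q"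
    by (rule finite_weak_compositions) simp
  have "poly (map_poly of_nat (P_cl_poly n l)) w = fps_nth (\<Prod>i<n + 1. Abs_fps (\<lambda>k. (w ^ i) ^ k)) l"
    unfolding poly_P_cl_poly by (subst fps_prod_nth_fun) (simp_all add: P_cl_eq)
  also have "\<dots> = fps_nth (\<Prod>j<s. Abs_fps (\<lambda>k. if d dvd k then 1 else 0)) l"
    unfolding assms(2) fps_prod_root_powers_blocks[OF assms(1)] ..
  also have "\<dots> = (\<Sum>q\<in>?Q. \<Prod>j<s. if d dvd q j then 1 else 0)"
    by (subst fps_prod_nth_fun) simp_all
  also have "\<dots> = (\<Sum>q\<in>?Q. if \<forall>j<s. d dvd q j then 1 else 0)"
  proof (rule sum.cong[OF refl])
    fix q
    show "(\<Prod>j<s. if d dvd q j then 1 else 0) = (if \<forall>j<s. d dvd q j then 1 else 0 :: complex)"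
    proof (cases "\<forall>j<s. d dvd q j")
      case False
      then obtain j where "j \<in> {..<s}" "(if d dvd q j then 1 else 0 :: complex) = 0"
        by auto
      with False show ?thesis
        by (subst prod_zero) auto
    qed simp
  qed
  also have "\<dots> = of_nat (card {q \<in> ?Q. \<forall>j<s. d dvd q j})"
    using fin by (simp add: sum.If_cases Int_def)
  finally show ?thesis
    by simp
qed

section \<open>The rotation action on weights\<close>

lemma weight_rot_in_P_cl:
  assumes "m \<in> P_cl n l"
  shows "weight_rot n m \<in> P_cl n l"
proof -
  have "(\<Sum>i<n + 1. weight_rot n m i) = (\<Sum>i<n. m (Suc i)) + m 0"
    by (simp add: weight_rot_def)
  also have "\<dots> = (\<Sum>i<n + 1. m i)"
    by (simp add: sum.lessThan_Suc_shift del: sum.lessThan_Suc)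
  finally show ?thesis
    using assms by (auto simp: P_cl_eq weight_rot_def)
qed

lemma weight_rot_funpow_in_P_cl:
  "m \<in> P_cl n l \<Longrightarrow> (weight_rot n ^^ k) m \<in> P_cl n l"
  by (induction k) (auto intro: weight_rot_in_P_cl)

lemma weight_rot_funpow:
  assumes "m \<in> P_cl n l"
  shows "(weight_rot n ^^ k) m i = (if i \<le> n then m ((i + k) mod (n + 1)) else 0)"
proof (induction k arbitrary: i)
  case 0
  \<comment> \<open>Before any rotation, the value \<open>0\<close> beyond \<open>n\<close> comes
    from membership in \<open>P_cl\<close>.\<close>
  then show ?case
    using assms by (auto simp: P_cl_def)
next
  case (Suc k)
  \<comment> \<open>This is the wrap-around: at index \<open>n\<close>, \<open>weight_rot\<close>
    reads entry \<open>0\<close> of the previous iterate, which is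
    \<open>m (k mod (n + 1))\<close>.\<close>
  have "(n + Suc k) mod (n + 1) = k mod (n + 1)"
    using mod_add_self1[of "n + 1" k] by simp
  then show ?case
    by (auto simp: weight_rot_def[of n "(weight_rot n ^^ k) m"] Suc)
qed

text \<open>Exponents matter only modulo \<open>n + 1\<close>; this yields both the inverse of the
  rotation and the homomorphism property of the action.\<close>

lemma weight_rot_funpow_mod:
  assumes "m \<in> P_cl n l"
  shows "(weight_rot n ^^ (k mod (n + 1))) m = (weight_rot n ^^ k) m"
  using assms by (auto simp: weight_rot_funpow mod_add_right_eq)

lemma rot_action_in_Bij: "rot_action n l k \<in> Bij (P_cl n l)"
proof -
  have "bij_betw (weight_rot n) (P_cl n l) (P_cl n l)"
  \<comment> \<open>Since \<open>n + 1\<close> rotations are the identity on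
    \<open>P_cl n l\<close>, \<open>n\<close> of them invert a single one.\<close>
  proof (rule bij_betw_byWitness[where f' = "weight_rot n ^^ n"])
    have "(weight_rot n ^^ Suc n) m = m" if "m \<in> P_cl n l" for m
      using weight_rot_funpow_mod[OF that, of "Suc n"] by simp
    then show "\<forall>m\<in>P_cl n l. (weight_rot n ^^ n) (weight_rot n m) = m"
      and "\<forall>m\<in>P_cl n l. weight_rot n ((weight_rot n ^^ n) m) = m"
      by (simp_all add: funpow_swap1)
  qed (auto intro: weight_rot_in_P_cl weight_rot_funpow_in_P_cl)
  then have "bij_betw (weight_rot n ^^ nat k) (P_cl n l) (P_cl n l)"
    by (rule bij_betw_funpow)
  then show ?thesis
    by (simp add: Bij_def rot_action_def)
qed

text \<open>The group law reduces sums modulo \<open>n + 1\<close>, whereas composing iterates adds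
  exponents without reduction; on \<open>P_cl n l\<close> the results coincide.\<close>

lemma group_action_rot_action:
  "group_action (integer_mod_group (n + 1)) (P_cl n l) (rot_action n l)"
proof -
  have "rot_action n l ((x + y) mod int (n + 1)) =
      compose (P_cl n l) (rot_action n l x) (rot_action n l y)"
    if "0 \<le> x" "0 \<le> y" for x y
  proof
    fix m
    have "nat ((x + y) mod int (n + 1)) = (nat x + nat y) mod (n + 1)"
      using that by (simp add: nat_mod_distrib nat_add_distrib)
    then show "rot_action n l ((x + y) mod int (n + 1)) m =
        compose (P_cl n l) (rot_action n l x) (rot_action n l y) m"
      using weight_rot_funpow_mod[of m n l "nat x + nat y"]
      by (simp add: rot_action_def compose_def weight_rot_funpow_in_P_cl funpow_add)
  qed
  then show ?thesis
    unfolding group_action_def group_hom_def group_hom_axioms_def hom_def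
    by (simp add: group_BijGroup)
      (auto simp: BijGroup_def rot_action_in_Bij carrier_integer_mod_group)
qed

section \<open>Generators and element orders in the integers modulo \<open>N\<close>\<close>

lemma cyclic_group_integer_mod_group: "cyclic_group (integer_mod_group n)"
proof (cases "n = 0")
  case True
  then show ?thesis
    by (simp add: integer_mod_group_def)
next
  case False
  interpret group "integer_mod_group n"
    by simp
  have "x \<in> range (\<lambda>k. k mod int n)" if "0 \<le> x" "x < int n" for x
    using that by (intro image_eqI[of _ _ x]) auto
  \<comment> \<open>The generator is \<open>1 mod int n\<close> because for \<open>n = 1\<close> the
    carrier is \<open>{0}\<close>.\<close>
  then show ?thesis
    unfolding cyclic_group int_pow_integer_mod_group
    using False by (intro bexI[of _ "1 mod int n"]) (auto simp: carrier_integer_mod_group mod_mult_right_eq)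
qed

text \<open>The order is \<open>N div gcd (nat k) N\<close>; the multiplicative form directly
  supplies a factorization \<open>n + 1 = s * d\<close>.\<close>

lemma ord_integer_mod_group:
  assumes "0 < N" "0 \<le> k" "k < int N"
  shows "N = gcd (nat k) N * group.ord (integer_mod_group N) k"
proof -
  interpret group "integer_mod_group N"
    by simp
  obtain a where a: "k = int a"
    using assms(2) nonneg_int_cases by blast
  have car: "k \<in> carrier (integer_mod_group N)"
    using assms by (simp add: carrier_integer_mod_group)
  have "ord k = N div gcd a N"
    unfolding ord_unique[OF car]
  proof
    fix j :: nat
    have "(int j * k) mod int N = 0 \<longleftrightarrow> N dvd j * a"
      unfolding a by (simp add: mod_eq_0_iff_dvd flip: of_nat_mult)
    also have "\<dots> \<longleftrightarrow> N div gcd a N dvd j"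
    proof -
      \<comment> \<open>After cancelling \<open>g\<close>, the cofactor \<open>a'\<close> is coprime
        to \<open>N'\<close> and drops out of the divisibility.\<close>
      define g where "g = gcd a N"
      have g: "g \<noteq> 0" using assms(1) by (simp add: g_def)
      obtain a' N' where *: "a = a' * g" "N = N' * g" "coprime a' N'"
        using gcd_coprime_exists[of a N] g unfolding g_def by auto
      have "N dvd j * a \<longleftrightarrow> N' dvd j"
        using * g by (simp add: coprime_commute coprime_dvd_mult_left_iff mult.assoc[symmetric])
      moreover have "N div gcd a N = N'"
        unfolding g_def[symmetric] using *(2) g by simp
      ultimately show ?thesis
        by simp
    qed
    finally show "k [^]\<^bsub>integer_mod_group N\<^esub> j = \<one>\<^bsub>integer_mod_group N\<^esub> \<longleftrightarrow> N div gcd a N dvd j"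
      by simp
  qed
  then show ?thesis
    by (simp add: a)
qed

section \<open>Fixed points as periodic weights\<close>

text \<open>By Bezout, the periods \<open>k\<close> and \<open>N\<close> generate the period
  \<open>gcd k N\<close>. Conversely, this gcd divides both, so shifting by \<open>k\<close> modulo
  \<open>N\<close> preserves residues modulo it.\<close>

lemma periodic_mod_iff:
  fixes m :: "nat \<Rightarrow> 'a"
  assumes "0 < N"
  shows "(\<forall>i<N. m ((i + k) mod N) = m i) \<longleftrightarrow> (\<forall>i<N. m i = m (i mod gcd k N))"
proof
  assume *: "\<forall>i<N. m ((i + k) mod N) = m i"
  \<comment> \<open>The \<open>N\<close>-periodic extension of \<open>m\<close> turns cyclic shifts
    into plain translations.\<close>
  define f where "f i = m (i mod N)" for i
  have k: "f (i + k * x) = f i" for i x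
  proof (induction x)
    case (Suc x)
    have "f (i + k * Suc x) = f ((i + k * x) + k)"
      by (simp add: algebra_simps)
    also have "\<dots> = f (i + k * x)"
      using *[rule_format, of "(i + k * x) mod N"] assms by (simp add: f_def mod_add_left_eq)
    finally show ?case
      using Suc by simp
  qed simp
  have N: "f (i + N * y) = f i" for i y
    by (simp add: f_def)
  have "f (i + gcd k N) = f i" for i
  proof (cases "k = 0")
    case False
    \<comment> \<open>Bezout in subtraction-free form, for \<open>k\<close> nonzero; for
      \<open>k = 0\<close> the gcd is \<open>N\<close>, already a period.\<close>
    then obtain x y where "k * x = N * y + gcd k N"
      using bezout_nat by blast
    then have "f (i + k * x) = f (i + gcd k N + N * y)"
      by (simp add: algebra_simps)
    then show ?thesis
      by (simp add: k N)
  qed (use N[of i 1] in simp)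
  then have "f (i + gcd k N * c) = f i" for i c
    by (induction c) (simp_all add: add.assoc[symmetric] add.commute[of "gcd k N"])
  then have "f i = f (i mod gcd k N)" for i
    by (metis mod_mult_div_eq)
  then show "\<forall>i<N. m i = m (i mod gcd k N)"
    unfolding f_def by (metis mod_less mod_less_eq_dividend order_le_less_trans)
next
  assume *: "\<forall>i<N. m i = m (i mod gcd k N)"
  show "\<forall>i<N. m ((i + k) mod N) = m i"
  proof (intro allI impI)
    fix i assume "i < N"
    have "m ((i + k) mod N) = m (((i + k) mod N) mod gcd k N)"
      using * assms by simp
    also have "((i + k) mod N) mod gcd k N = i mod gcd k N"
      by (metis add.right_neutral gcd_dvd1 gcd_dvd2 dvd_imp_mod_0 mod_add_right_eq mod_mod_cancel)
    finally show "m ((i + k) mod N) = m i"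
      using * \<open>i < N\<close> by simp
  qed
qed

lemma invariants_rot_action:
  "invariants (P_cl n l) (rot_action n l) k =
    {m \<in> P_cl n l. \<forall>i<n + 1. m i = m (i mod gcd (nat k) (n + 1))}"
proof -
  have "rot_action n l k m = m \<longleftrightarrow> (\<forall>i<n + 1. m ((i + nat k) mod (n + 1)) = m i)"
    if m: "m \<in> P_cl n l" for m
  proof -
    \<comment> \<open>Entries beyond \<open>n\<close> vanish on both sides, so being fixed only
      constrains the first \<open>n + 1\<close> entries.\<close>
    have "\<forall>i>n. m i = 0"
      using m by (simp add: P_cl_def)
    then show ?thesis
      using m by (auto simp: rot_action_def fun_eq_iff weight_rot_funpow not_le less_Suc_eq_le)
  qed
  then show ?thesis
    unfolding invariants_def by (auto simp: periodic_mod_iff)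
qed

text \<open>The range splits into \<open>d\<close> blocks of length \<open>s\<close>, each repeating
  the first.\<close>

lemma sum_periodic:
  fixes m :: "nat \<Rightarrow> nat"
  assumes "\<forall>i<s * d. m i = m (i mod s)"
  shows "sum m {..<s * d} = d * sum m {..<s}"
proof -
  have "sum m {c * s..<c * s + s} = sum m {..<s}" if "c < d" for c
  proof -
    have "m (c * s + j) = m j" if "j < s" for j
    proof -
      have "c * s + j < Suc c * s"
        using that by simp
      also have "\<dots> \<le> s * d"
        using \<open>c < d\<close> by (subst mult.commute) (intro mult_le_mono, auto)
      finally have "m (c * s + j) = m ((c * s + j) mod s)"
        using assms by blast
      then show ?thesis
        using that by simp
    qed
    then show ?thesis
      using sum.shift_bounds_nat_ivl[of m 0 "c * s" s]
      by (simp add: add.commute lessThan_atLeast0)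
  qed
  then show ?thesis
    by (subst mult.commute, subst sum.nat_group[symmetric]) simp
qed

text \<open>Scaling the first period by \<open>d\<close> makes up for the loss of its
  \<open>d\<close> repetitions, so the total stays \<open>l\<close>. The inverse divides by
  \<open>d\<close>, exactly on multiples of \<open>d\<close>, and repeats.\<close>

lemma card_periodic_P_cl:
  assumes "n + 1 = s * d"
  shows "card {m \<in> P_cl n l. \<forall>i<n + 1. m i = m (i mod s)} =
    card {q. (\<forall>j. j \<notin> {..<s} \<longrightarrow> q j = 0) \<and> sum q {..<s} = l \<and> (\<forall>j<s. d dvd q j)}"
    (is "card ?M = card ?Q")
proof -
  let ?f = "\<lambda>m j. if j < s then d * m j else 0"
  let ?g = "\<lambda>q i. if i < n + 1 then q (i mod s) div d else 0"
  have pos: "0 < s" "0 < d"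
    using assms by (auto intro: gr0I)
  have le: "s \<le> n + 1"
    unfolding assms using pos by simp
  have gf: "\<forall>m\<in>?M. ?g (?f m) = m"
  proof (intro ballI ext)
    fix m i assume m: "m \<in> ?M"
    then have m: "m \<in> P_cl n l" and per: "\<forall>i<n + 1. m i = m (i mod s)"
      by blast+
    have "m (i mod s) = m i" if "i < n + 1"
      by (rule per[rule_format, OF that, symmetric])
    moreover have "m i = 0" if "\<not> i < n + 1"
      using m that by (simp add: P_cl_def)
    ultimately show "?g (?f m) i = m i"
      using pos by (cases "i < n + 1") simp_all
  qed
  have fg: "\<forall>q\<in>?Q. ?f (?g q) = q"
    using pos le by (auto simp: fun_eq_iff)
  have f: "?f ` ?M \<subseteq> ?Q"
  proof (intro image_subsetI)
    fix m assume m: "m \<in> ?M"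
    then have "sum m {..<s * d} = d * sum m {..<s}"
      unfolding assms by (intro sum_periodic) blast
    then show "?f m \<in> ?Q"
      using m unfolding P_cl_eq assms by (auto simp del: mult_Suc simp flip: sum_distrib_left)
  qed
  have g: "?g ` ?Q \<subseteq> ?M"
  proof (intro image_subsetI)
    fix q assume q: "q \<in> ?Q"
    \<comment> \<open>Reducing an index modulo \<open>s\<close> never reaches the default value
      \<open>0\<close> of \<open>?g\<close>, so \<open>?g q\<close> is periodic.\<close>
    have "i mod s < n + 1" for i
      using pos le by (meson mod_less_divisor order_less_le_trans)
    then have per: "\<forall>i<s * d. ?g q i = ?g q (i mod s)"
      unfolding assms[symmetric] by simp
    have "sum (?g q) {..<n + 1} = d * sum (?g q) {..<s}"
      unfolding assms using sum_periodic[OF per] unfolding assms .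
    also have "\<dots> = (\<Sum>j<s. q j)"
      unfolding sum_distrib_left by (rule sum.cong) (use q le in auto)
    finally show "?g q \<in> ?M"
      using q per unfolding P_cl_eq assms[symmetric] mem_Collect_eq by (intro conjI) auto
  qed
  show ?thesis
    by (rule bij_betw_same_card[OF bij_betw_byWitness[OF gf fg f g]])
qed

theorem theorem4p2:
  fixes n l :: nat
  assumes "n \<ge> 1"
  shows "cyclic_sieving (integer_mod_group (n + 1)) (P_cl n l) (rot_action n l) (P_cl_poly n l)"
  unfolding cyclic_sieving_def
proof (intro conjI ballI allI impI)
  fix k w
  assume k: "k \<in> carrier (integer_mod_group (n + 1))"
    and w: "primitive_root_of_unity (group.ord (integer_mod_group (n + 1)) k) w"
  \<comment> \<open>One factorization serves both sides: the gcd is the period of the fixed weights,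
    and the cofactor is the order of \<open>w\<close>.\<close>
  have eq: "n + 1 = gcd (nat k) (n + 1) * group.ord (integer_mod_group (n + 1)) k"
    by (rule ord_integer_mod_group) (use k in \<open>auto simp: carrier_integer_mod_group\<close>)
  show "of_nat (card (invariants (P_cl n l) (rot_action n l) k)) =
      poly (map_poly of_nat (P_cl_poly n l)) w"
    unfolding invariants_rot_action card_periodic_P_cl[OF eq]
      poly_P_cl_poly_root_of_unity[OF w eq] ..
qed (use group_action_rot_action[of n l] in
    \<open>simp_all add: finite_P_cl cyclic_group_integer_mod_group carrier_integer_mod_group\<close>)

end
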